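(* Let $\zeta_1,\ldots,\zeta_n$ be $n$ i.i.d. real random variables and let $\xi_1,\ldots,\xi_n$ be real random variables. Suppose the conditional null hypothesis is true: conditionally on $(\zeta_1,\ldots,\zeta_n)$ the variables $\xi_1,\ldots,\xi_n$ are independent and each $\xi_i$ is distributed with the conditional CDF $F_{\zeta_i}(\cdot)$, i.e. $P(\xi_i\le x\mid\zeta_i)=F_{\zeta_i}(x)$. Suppose each $F_{\zeta_i}(\cdot)$ is continuous. Let $$S_n=\sup_{x\in[0,1]}\left|\frac1n\sum_{i=1}^n\mathbf{1}_{[0,x]}\left(F_{\zeta_i}(\xi_i)\right)-x\right|.$$ Then $S_n$ is KS distributed (Kolmogorov–Smirnov distributed with parameter $n$).
   Context: Here $F_u(x)=\int_{-\infty}^x f(s,u)\,ds$, where $f(\cdot,\cdot)$ is a (measurable) conditional PDF of $\xi$ given $\zeta=u$, and $\mathbf{1}_A$ is the indicator function of $A$. KS distribution: if $\eta_1,\ldots,\eta_n$ are i.i.d. real random variables with continuous CDF $F$, the Kolmogorov–Smirnov statistic is $D_n=\sup_{x\in\mathbb{R}}\left|\frac1n\sum_{i=1}^n\mathbf{1}_{(-\infty,x]}(\eta_i)-F(x)\right|$. The law of $D_n$ depends only on $n$ and not on $F$; this law is called the KS distribution (with parameter $n$). A random variable is KS distributed if it has this law. *)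

theory Defs
  imports "HOL-Probability.Probability"
begin

section \<open>The Kolmogorov-Smirnov distribution\<close>

definition KS_stat :: "nat \<Rightarrow> (real \<Rightarrow> real) \<Rightarrow> (nat \<Rightarrow> real) \<Rightarrow> real" where
  "KS_stat n F \<eta> = (SUP x. \<bar>(1 / real n) * (\<Sum>i=1..n. indicator {..x} (\<eta> i)) - F x\<bar>)"

text \<open>
  Here \<open>\<mu>\<close> is the common law of an i.i.d. sample \<open>\<eta>\<^sub>1, \<dots>, \<eta>\<^sub>n\<close>, realised as the
  coordinates of the product space, and \<^term>\<open>cdf \<mu>\<close> is its continuous CDF. Since the
  law of the statistic does not depend on \<open>\<mu>\<close>, agreement with one such law and agreement
  with all of them amount to the same thing. The definition asks for all of them, so that
  it does not itself rely on this independence of \<open>\<mu>\<close>.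
\<close>

definition KS_distributed :: "nat \<Rightarrow> 'a measure \<Rightarrow> ('a \<Rightarrow> real) \<Rightarrow> bool" where
  "KS_distributed n M S \<longleftrightarrow>
     S \<in> borel_measurable M \<and>
     (\<forall>\<mu>. real_distribution \<mu> \<and> continuous_on UNIV (cdf \<mu>) \<longrightarrow>
        distr M borel S = distr (\<Pi>\<^sub>M i\<in>{1..n}. \<mu>) borel (KS_stat n (cdf \<mu>)))"


section \<open>Conditional densities and conditional CDFs\<close>

text \<open>
  As usual for conditional densities, \<open>f(\<cdot>,u)\<close> is required to be a density only for
  almost every \<open>u\<close> with respect to the law \<open>\<nu>\<close> of the conditioning variable.
\<close>

definition conditional_pdf :: "real measure \<Rightarrow> (real \<Rightarrow> real \<Rightarrow> real) \<Rightarrow> bool" where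
  "conditional_pdf \<nu> f \<longleftrightarrow>
     (\<lambda>(s, u). f s u) \<in> borel_measurable (borel \<Otimes>\<^sub>M borel) \<and>
     (AE u in \<nu>. (\<forall>s. 0 \<le> f s u) \<and> (\<integral>\<^sup>+ s. ennreal (f s u) \<partial>lborel) = 1)"

definition cond_cdf :: "(real \<Rightarrow> real \<Rightarrow> real) \<Rightarrow> real \<Rightarrow> real \<Rightarrow> real" where
  "cond_cdf f u x = (LINT s:{..x}|lborel. f s u)"


section \<open>The conditional null hypothesis\<close>

definition gen_sigma :: "'a measure \<Rightarrow> nat \<Rightarrow> (nat \<Rightarrow> 'a \<Rightarrow> real) \<Rightarrow> 'a measure" where
  "gen_sigma M n \<zeta> =
     vimage_algebra (space M) (\<lambda>\<omega>. \<lambda>i\<in>{1..n}. \<zeta> i \<omega>) (\<Pi>\<^sub>M i\<in>{1..n}. borel)"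

text \<open>
  Conditional independence given a sub-\<open>\<sigma>\<close>-algebra \<open>G\<close>. Subfamilies are covered by
  taking some of the sets to be \<^term>\<open>UNIV\<close>.
\<close>

definition cond_indep_given :: "'a measure \<Rightarrow> 'a measure \<Rightarrow> nat \<Rightarrow> (nat \<Rightarrow> 'a \<Rightarrow> real) \<Rightarrow> bool" where
  "cond_indep_given M G n \<xi> \<longleftrightarrow>
     (\<forall>A. (\<forall>i\<in>{1..n}. A i \<in> sets borel) \<longrightarrow>
        (AE \<omega> in M.
           real_cond_exp M G (indicator {\<omega>' \<in> space M. \<forall>i\<in>{1..n}. \<xi> i \<omega>' \<in> A i}) \<omega> =
           (\<Prod>i=1..n. real_cond_exp M G (indicator {\<omega>' \<in> space M. \<xi> i \<omega>' \<in> A i}) \<omega>)))"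

text \<open>
  The conditional CDF of \<open>\<xi>\<^sub>i\<close> is prescribed given the whole vector
  \<open>(\<zeta>\<^sub>1, \<dots>, \<zeta>\<^sub>n)\<close>; the lemma \<open>cond_null_hypothesis_single\<close> below derives from this
  the formula \<open>P(\<xi>\<^sub>i \<le> x | \<zeta>\<^sub>i) = F\<^bsub>\<zeta>\<^sub>i\<^esub>(x)\<close>.
\<close>

definition cond_null_hypothesis ::
  "'a measure \<Rightarrow> nat \<Rightarrow> (real \<Rightarrow> real \<Rightarrow> real) \<Rightarrow> (nat \<Rightarrow> 'a \<Rightarrow> real) \<Rightarrow> (nat \<Rightarrow> 'a \<Rightarrow> real) \<Rightarrow> bool" where
  "cond_null_hypothesis M n f \<zeta> \<xi> \<longleftrightarrow>
     cond_indep_given M (gen_sigma M n \<zeta>) n \<xi> \<and>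
     (\<forall>i\<in>{1..n}. \<forall>x. AE \<omega> in M.
        real_cond_exp M (gen_sigma M n \<zeta>) (indicator {\<omega>' \<in> space M. \<xi> i \<omega>' \<le> x}) \<omega> =
        cond_cdf f (\<zeta> i \<omega>) x)"

definition KS_cond_stat ::
  "nat \<Rightarrow> (real \<Rightarrow> real \<Rightarrow> real) \<Rightarrow> (nat \<Rightarrow> real) \<Rightarrow> (nat \<Rightarrow> real) \<Rightarrow> real" where
  "KS_cond_stat n f z y =
     (SUP x\<in>{0..1}. \<bar>(1 / real n) * (\<Sum>i=1..n. indicator {0..x} (cond_cdf f (z i) (y i))) - x\<bar>)"

lemma borel_measurable_cond_cdf:
  assumes "(\<lambda>(s, u). f s u) \<in> borel_measurable (borel \<Otimes>\<^sub>M borel)"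
  shows "(\<lambda>u. cond_cdf f u x) \<in> borel_measurable borel"
proof -
  have "(\<lambda>p. indicator {..x} (snd p) *\<^sub>R (\<lambda>(s, u). f s u) (snd p, fst p))
          \<in> borel_measurable (borel \<Otimes>\<^sub>M lborel)"
    by (intro borel_measurable_scaleR measurable_compose[OF _ assms]
              borel_measurable_indicator' measurable_Pair) measurable
  then have "(\<lambda>(u, s). indicator {..x} s *\<^sub>R f s u) \<in> borel_measurable (borel \<Otimes>\<^sub>M lborel)"
    by (simp add: case_prod_unfold)
  then show ?thesis
    unfolding cond_cdf_def set_lebesgue_integral_def
    by (rule lborel.borel_measurable_lebesgue_integral)
qed

lemma cond_null_hypothesis_single:
  assumes "prob_space M"
    and \<zeta>: "\<And>i. i \<in> {1..n} \<Longrightarrow> \<zeta> i \<in> borel_measurable M"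
    and \<xi>: "\<And>i. i \<in> {1..n} \<Longrightarrow> \<xi> i \<in> borel_measurable M"
    and f: "(\<lambda>(s, u). f s u) \<in> borel_measurable (borel \<Otimes>\<^sub>M borel)"
    and H: "cond_null_hypothesis M n f \<zeta> \<xi>"
    and i: "i \<in> {1..n}"
  shows "AE \<omega> in M.
           real_cond_exp M (vimage_algebra (space M) (\<zeta> i) borel)
             (indicator {\<omega>' \<in> space M. \<xi> i \<omega>' \<le> x}) \<omega> = cond_cdf f (\<zeta> i \<omega>) x"
proof -
  interpret prob_space M by fact
  define G where "G = gen_sigma M n \<zeta>"
  define H1 where "H1 = vimage_algebra (space M) (\<zeta> i) (borel :: real measure)"
  define I where "I = (indicator {\<omega>' \<in> space M. \<xi> i \<omega>' \<le> x} :: _ \<Rightarrow> real)"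
  have vec: "(\<lambda>\<omega>. \<lambda>i\<in>{1..n}. \<zeta> i \<omega>) \<in> measurable M (\<Pi>\<^sub>M i\<in>{1..n}. borel)"
    using \<zeta> by (intro measurable_restrict) auto
  have "sets G \<subseteq> sets M"
    unfolding G_def gen_sigma_def using vec
    by (auto simp: sets_vimage_algebra2 space_PiM dest: measurable_sets)
  then have MG: "subalgebra M G"
    by (simp add: subalgebra_def G_def gen_sigma_def)
  have "(\<lambda>\<omega>. (\<lambda>i\<in>{1..n}. \<zeta> i \<omega>) i) \<in> borel_measurable G"
    unfolding G_def gen_sigma_def
    by (rule measurable_compose[OF measurable_vimage_algebra1 measurable_component_singleton])
       (use i in \<open>auto simp: space_PiM\<close>)
  then have \<zeta>G: "\<zeta> i \<in> borel_measurable G" using i by simp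
  have spG: "space G = space M" by (simp add: G_def gen_sigma_def)
  have "sets H1 \<subseteq> sets G"
    unfolding H1_def using measurable_sets[OF \<zeta>G] spG by (auto simp: sets_vimage_algebra2)
  then have GH: "subalgebra G H1"
    by (simp add: subalgebra_def H1_def spG)
  have MH: "subalgebra M H1"
    using MG GH by (auto simp: subalgebra_def)
  interpret G: sigma_finite_subalgebra M G
    by (rule finite_measure_subalgebra_is_sigma_finite)
       (use MG in \<open>auto intro!: finite_measure_subalgebra.intro finite_measure_subalgebra_axioms.intro
          simp: finite_measure_axioms\<close>)
  interpret H1: sigma_finite_subalgebra M H1
    by (rule finite_measure_subalgebra_is_sigma_finite)
       (use MH in \<open>auto intro!: finite_measure_subalgebra.intro finite_measure_subalgebra_axioms.intro
          simp: finite_measure_axioms\<close>)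
  have "{\<omega>' \<in> space M. \<xi> i \<omega>' \<le> x} \<in> sets M"
    using \<xi>[OF i] by measurable
  then have I: "integrable M I"
    unfolding I_def by (intro integrable_real_indicator) (auto simp: emeasure_eq_measure)
  have \<zeta>H: "\<zeta> i \<in> borel_measurable H1"
    unfolding H1_def by (rule measurable_vimage_algebra1) auto
  have FH: "(\<lambda>\<omega>. cond_cdf f (\<zeta> i \<omega>) x) \<in> borel_measurable H1"
    by (rule measurable_compose[OF \<zeta>H borel_measurable_cond_cdf[OF f]])
  have FM: "(\<lambda>\<omega>. cond_cdf f (\<zeta> i \<omega>) x) \<in> borel_measurable M"
    by (rule measurable_compose[OF \<zeta>[OF i] borel_measurable_cond_cdf[OF f]])
  have e: "AE \<omega> in M. real_cond_exp M G I \<omega> = cond_cdf f (\<zeta> i \<omega>) x"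
    using H i by (auto simp: cond_null_hypothesis_def G_def I_def)
  have "integrable M (\<lambda>\<omega>. cond_cdf f (\<zeta> i \<omega>) x)"
    using integrable_cong_AE[OF borel_measurable_cond_exp2 FM e] G.real_cond_exp_int(1)[OF I]
    by blast
  then have 1: "AE \<omega> in M. real_cond_exp M H1 (\<lambda>\<omega>. cond_cdf f (\<zeta> i \<omega>) x) \<omega> = cond_cdf f (\<zeta> i \<omega>) x"
    by (rule H1.real_cond_exp_F_meas[OF _ FH])
  have 2: "AE \<omega> in M. real_cond_exp M H1 (real_cond_exp M G I) \<omega> =
      real_cond_exp M H1 (\<lambda>\<omega>. cond_cdf f (\<zeta> i \<omega>) x) \<omega>"
    by (rule H1.real_cond_exp_cong[OF e borel_measurable_cond_exp2 FM])
  have 3: "AE \<omega> in M. real_cond_exp M H1 (real_cond_exp M G I) \<omega> = real_cond_exp M H1 I \<omega>"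
    by (rule H1.real_cond_exp_nested_subalg[OF MG GH I])
  show ?thesis
    using 1 2 3 unfolding H1_def[symmetric] I_def[symmetric] by eventually_elim simp
qed

end

theory Submission
  imports Defs
begin

text \<open>
  Write \<open>U\<^sub>i = F\<^bsub>\<zeta>\<^sub>i\<^esub>(\<xi>\<^sub>i)\<close>. The statistic \<open>S\<^sub>n\<close> is the Kolmogorov-Smirnov statistic of
  \<open>U\<^sub>1, \<dots>, U\<^sub>n\<close> against the uniform distribution on \<open>[0, 1]\<close>. Everything follows once the \<open>U\<^sub>i\<close>
  are known to be independent and uniform, since the classical statistic of an i.i.d. sample with
  continuous CDF \<open>F\<close> is almost surely a function of the uniform sample \<open>F(\<eta>\<^sub>i)\<close>, and it is the
  same function (lemma \<open>distr_KS_stat_eq\<close>).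

  Since \<open>U\<^sub>i\<close> depends on both \<open>\<zeta>\<^sub>i\<close> and \<open>\<xi>\<^sub>i\<close>, independence is proved for the pairs
  \<open>(\<zeta>\<^sub>i, \<xi>\<^sub>i)\<close> (lemma \<open>indep_vars_pairs\<close>): given the vector \<open>\<zeta>\<close>, the
  probability of a box of half-lines is the product of the \<open>F\<^bsub>\<zeta>\<^sub>i\<^esub>(x\<^sub>i)\<close>, each factor involves a
  single \<open>\<zeta>\<^sub>i\<close>, and the \<open>\<zeta>\<^sub>i\<close> are independent. Each \<open>U\<^sub>i\<close> is a measurable function of its pair.

  Uniformity comes from the probability integral transform applied to each density \<open>f(\<cdot>, u)\<close>
  (lemmas \<open>measure_cdf_le\<close> and \<open>prob_cond_cdf_le\<close>). The pair \<open>(\<zeta>\<^sub>i, \<xi>\<^sub>i)\<close> has joint law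
  \<open>f(s, u) \<nu>(du) ds\<close> (lemma \<open>distr_pair_eq_density\<close>), so \<open>P(U\<^sub>i \<le> t)\<close> is the \<open>\<nu>\<close>-average of
  quantities that all equal \<open>t\<close> for \<open>t\<close> in \<open>[0, 1]\<close>.
\<close>

section \<open>The probability integral transform\<close>

lemma ex_cdf_eq:
  assumes "real_distribution \<mu>" "continuous_on UNIV (cdf \<mu>)" and r: "0 < r" "r < 1"
  shows "\<exists>a. cdf \<mu> a = r"
proof -
  interpret real_distribution \<mu> by fact
  obtain a where a: "cdf \<mu> a < r"
    using order_tendstoD(2)[OF cdf_lim_at_bot r(1)] by (auto simp: eventually_at_bot_linorder)
  obtain b where b: "r < cdf \<mu> b"
    using order_tendstoD(1)[OF cdf_lim_at_top_prob r(2)] by (auto simp: eventually_at_top_linorder)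
  have "a \<le> b" using a b cdf_nondecreasing[of b a] by linarith
  then show ?thesis
    using IVT'[of "cdf \<mu>" a r b] a b continuous_on_subset[OF assms(2)] by auto
qed

text \<open>
  The probability integral transform, for continuous CDFs that need not be strictly
  increasing. For a quantile \<open>a\<close> with \<open>F a = r\<close> in \<open>(0, 1)\<close>, monotonicity gives the
  inclusions \<open>{s. F s < r} \<subseteq> {..a} \<subseteq> {s. F s \<le> r}\<close>, hence \<open>P(F < r) \<le> r \<le> P(F \<le> r)\<close>. The
  strict form loses nothing, because \<open>P(F \<le> t) \<le> P(F < r) \<le> r\<close> for every \<open>r > t\<close>, so flat
  pieces of \<open>F\<close> need no separate treatment. The right-hand side is the CDF of the uniform
  distribution on \<open>[0, 1]\<close>, which serves below as the characterisation of that law.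
\<close>

lemma measure_cdf_le:
  assumes "real_distribution \<mu>" and cont: "continuous_on UNIV (cdf \<mu>)"
  shows "measure \<mu> {s. cdf \<mu> s \<le> t} = max 0 (min 1 t)"
proof -
  interpret real_distribution \<mu> by fact
  let ?F = "cdf \<mu>"
  have meas [measurable]: "?F \<in> borel_measurable borel"
    by (rule borel_measurable_continuous_onI[OF cont])
  have sets [measurable]: "{s. ?F s \<le> r} \<in> sets \<mu>" "{s. ?F s < r} \<in> sets \<mu>" for r
    by (auto intro!: sets_M)
  note quantile = ex_cdf_eq[OF assms]
  have lower: "r \<le> measure \<mu> {s. ?F s \<le> r}" if r: "0 < r" "r < 1" for r
  proof -
    obtain a where a: "?F a = r" using quantile[OF r] by blast
    have "measure \<mu> {..a} \<le> measure \<mu> {s. ?F s \<le> r}"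
      using a cdf_nondecreasing by (intro finite_measure_mono) auto
    then show ?thesis using a by (simp add: cdf_def2)
  qed
  have upper: "measure \<mu> {s. ?F s < r} \<le> r" if r: "0 < r" "r < 1" for r
  proof -
    obtain a where a: "?F a = r" using quantile[OF r] by blast
    have "s \<le> a" if "?F s < r" for s
      using that a cdf_nondecreasing[of a s] by linarith
    then have "measure \<mu> {s. ?F s < r} \<le> measure \<mu> {..a}"
      by (intro finite_measure_mono) auto
    then show ?thesis using a by (simp add: cdf_def2)
  qed
  have below: "measure \<mu> {s. ?F s \<le> t} \<le> max 0 t" if t: "t < 1"
  proof (rule dense_ge_bounded)
    show "max 0 t < 1" using t by simp
    fix r assume r: "max 0 t < r" "r < 1"
    have "measure \<mu> {s. ?F s \<le> t} \<le> measure \<mu> {s. ?F s < r}"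
      using r by (intro finite_measure_mono) auto
    also have "\<dots> \<le> r" using r by (intro upper) auto
    finally show "measure \<mu> {s. ?F s \<le> t} \<le> r" .
  qed
  consider "t \<le> 0" | "0 < t" "t < 1" | "1 \<le> t" by linarith
  then show ?thesis
  proof cases
    case 1
    with below show ?thesis using measure_nonneg[of \<mu> "{s. ?F s \<le> t}"] by simp
  next
    case 2
    with below lower[of t] show ?thesis by simp
  next
    case 3
    then have "{s. ?F s \<le> t} = space \<mu>"
      using cdf_bounded_prob by (auto intro: order_trans)
    then show ?thesis using 3 prob_space by simp
  qed
qed

lemma measure_distr_cdf_atMost:
  assumes "real_distribution \<mu>" and cont: "continuous_on UNIV (cdf \<mu>)"
  shows "measure (distr \<mu> borel (cdf \<mu>)) {..t} = max 0 (min 1 t)"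
proof -
  interpret real_distribution \<mu> by fact
  have "cdf \<mu> \<in> borel_measurable borel"
    by (rule borel_measurable_continuous_onI[OF cont])
  then have "measure (distr \<mu> borel (cdf \<mu>)) {..t} = measure \<mu> (cdf \<mu> -` {..t} \<inter> space \<mu>)"
    by (intro measure_distr) auto
  also have "cdf \<mu> -` {..t} \<inter> space \<mu> = {s. cdf \<mu> s \<le> t}"
    by auto
  finally show ?thesis
    using measure_cdf_le[OF assms] by simp
qed

lemma real_distribution_eqI_clamp:
  assumes "real_distribution P" "real_distribution Q"
    and "\<And>t. measure P {..t} = max 0 (min 1 t)" "\<And>t. measure Q {..t} = max 0 (min 1 t)"
  shows "P = Q"
  using assms by (intro cdf_unique) (auto simp: cdf_def)

text \<open>
  Almost no point \<open>s\<close> has a smaller point \<open>x\<close> with the same CDF value. Otherwise some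
  rational \<open>q\<close> between \<open>x\<close> and \<open>s\<close> would satisfy \<open>F s = F q\<close>; but the law of \<open>F\<close> is uniform
  and has no atoms, so each of these countably many events is null.
\<close>

lemma AE_cdf_less:
  assumes "real_distribution \<mu>" and cont: "continuous_on UNIV (cdf \<mu>)"
  shows "AE s in \<mu>. \<forall>x<s. cdf \<mu> x < cdf \<mu> s"
proof -
  interpret real_distribution \<mu> by fact
  have [measurable]: "cdf \<mu> \<in> borel_measurable borel"
    by (rule borel_measurable_continuous_onI[OF cont])
  interpret L: real_distribution "distr \<mu> borel (cdf \<mu>)"
    by (intro real_distribution_distr) simp
  have "cdf (distr \<mu> borel (cdf \<mu>)) = (\<lambda>t. max 0 (min 1 t))"
    by (simp add: fun_eq_iff cdf_def[of "distr \<mu> borel (cdf \<mu>)"] measure_distr_cdf_atMost[OF assms])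
  then have "isCont (cdf (distr \<mu> borel (cdf \<mu>))) c" for c
    by (simp add: continuous_intros)
  then have "measure (distr \<mu> borel (cdf \<mu>)) {c} = 0" for c
    using L.isCont_cdf by blast
  then have null: "measure \<mu> {s. cdf \<mu> s = c} = 0" for c
    by (simp add: measure_distr vimage_def)
  have "AE s in \<mu>. cdf \<mu> s \<noteq> cdf \<mu> q" for q
    using null[of "cdf \<mu> q"]
    by (intro AE_I[of _ _ "{s. cdf \<mu> s = cdf \<mu> q}"]) (auto simp: emeasure_eq_measure intro!: sets_M)
  then have "AE s in \<mu>. \<forall>q\<in>\<rat>. cdf \<mu> s \<noteq> cdf \<mu> q"
    by (subst AE_ball_countable) (auto simp: countable_rat)
  then show ?thesis
  proof eventually_elim
    case (elim s)
    show ?case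
    proof (intro allI impI)
      fix x assume "x < s"
      then obtain q where q: "x < q" "q < s" "q \<in> \<rat>" using Rats_dense_in_real by blast
      then have "cdf \<mu> x \<le> cdf \<mu> q" "cdf \<mu> q \<le> cdf \<mu> s" by (auto intro: cdf_nondecreasing)
      then show "cdf \<mu> x < cdf \<mu> s" using elim q by force
    qed
  qed
qed


section \<open>Measurability of suprema over a continuum\<close>

text \<open>
  Right-continuity lets the uncountable supremum be replaced by the one over the rationals:
  if \<open>h\<close> exceeds a level at \<open>x\<close>, then it does so at some rational to the right of \<open>x\<close>.
\<close>

lemma borel_measurable_SUP_right_continuous:
  fixes h :: "real \<Rightarrow> 'a \<Rightarrow> real"
  assumes meas: "\<And>x. h x \<in> borel_measurable M"
    and cont: "\<And>\<omega> x. continuous (at_right x) (\<lambda>x. h x \<omega>)"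
    and bdd: "\<And>\<omega>. bdd_above (range (\<lambda>x. h x \<omega>))"
  shows "(\<lambda>\<omega>. SUP x. h x \<omega>) \<in> borel_measurable M"
proof -
  have bddQ: "bdd_above ((\<lambda>x. h x \<omega>) ` \<rat>)" for \<omega>
    by (rule bdd_above_mono[OF bdd]) auto
  have "(SUP x. h x \<omega>) = (SUP x\<in>\<rat>. h x \<omega>)" for \<omega>
  proof (rule antisym)
    show "(SUP x. h x \<omega>) \<le> (SUP x\<in>\<rat>. h x \<omega>)"
    proof (rule cSUP_least, simp, rule ccontr)
      fix x assume "\<not> h x \<omega> \<le> (SUP x\<in>\<rat>. h x \<omega>)"
      then have "eventually (\<lambda>y. (SUP x\<in>\<rat>. h x \<omega>) < h y \<omega>) (at_right x)"
        using cont[of x \<omega>] by (intro order_tendstoD) (auto simp: continuous_within)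
      then obtain b where b: "x < b" "\<And>y. x < y \<Longrightarrow> y < b \<Longrightarrow> (SUP x\<in>\<rat>. h x \<omega>) < h y \<omega>"
        unfolding eventually_at_right_field by blast
      then obtain q where q: "x < q" "q < b" "q \<in> \<rat>" using Rats_dense_in_real by blast
      have "h q \<omega> \<le> (SUP x\<in>\<rat>. h x \<omega>)" by (rule cSUP_upper[OF q(3) bddQ])
      with b(2)[OF q(1,2)] show False by simp
    qed
  next
    show "(SUP x\<in>\<rat>. h x \<omega>) \<le> (SUP x. h x \<omega>)"
      using bdd Rats_0 by (intro cSUP_subset_mono) auto
  qed
  moreover have "(\<lambda>\<omega>. SUP x\<in>\<rat>. h x \<omega>) \<in> borel_measurable M"
    by (rule borel_measurable_cSUP[OF countable_rat]) (use meas bddQ in auto)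
  ultimately show ?thesis by simp
qed

lemma continuous_at_right_indicator_atMost:
  fixes g :: "real \<Rightarrow> real"
  assumes "mono g" "continuous_on UNIV g"
  shows "continuous (at_right x) (\<lambda>x. indicator (B \<inter> {..g x}) u :: real)"
proof -
  have "eventually (\<lambda>y. indicator (B \<inter> {..g y}) u = (indicator (B \<inter> {..g x}) u :: real)) (at_right x)"
  proof (cases "u \<le> g x")
    case True
    have "eventually (\<lambda>y. x < y) (at_right x)" by (rule eventually_at_right_less)
    then show ?thesis
    proof eventually_elim
      case (elim y)
      then have "g x \<le> g y" by (intro monoD[OF assms(1)]) simp
      with True show ?case by (auto simp: indicator_def)
    qed
  next
    case False
    have "(g \<longlongrightarrow> g x) (at_right x)"
      using assms(2) tendsto_within_subset[where f = g and S = UNIV and T = "{x<..}"]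
      by (simp add: continuous_on_def)
    then have "eventually (\<lambda>y. g y < u) (at_right x)"
      using False by (intro order_tendstoD) auto
    then show ?thesis
      by eventually_elim (use False in \<open>auto simp: indicator_def\<close>)
  qed
  then show ?thesis
    unfolding continuous_within by (rule tendsto_eventually)
qed

lemma empirical_bounds:
  "0 \<le> (1 / real n) * (\<Sum>i=1..n. indicator (S i) (u i))"
  "(1 / real n) * (\<Sum>i=1..n. indicator (S i) (u i)) \<le> (1 :: real)"
proof -
  have "(\<Sum>i=1..n. indicator (S i) (u i)) \<le> (\<Sum>i=1..n. 1 :: real)"
    by (intro sum_mono) (auto simp: indicator_def)
  then show "(1 / real n) * (\<Sum>i=1..n. indicator (S i) (u i)) \<le> (1 :: real)"
    by (cases "n = 0") (auto simp: field_simps)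
qed (intro mult_nonneg_nonneg sum_nonneg; simp)

lemma empirical_deviation_le_1:
  assumes "0 \<le> c" "c \<le> (1 :: real)"
  shows "\<bar>(1 / real n) * (\<Sum>i=1..n. indicator (S i) (u i)) - c\<bar> \<le> 1"
  using empirical_bounds[of n S u] assms by linarith

text \<open>
  This form covers both statistics. The usual Kolmogorov-Smirnov statistic has \<open>g = id\<close>,
  \<open>B = UNIV\<close> and the CDF as \<open>c\<close>. For the version on \<open>[0, 1]\<close>, the supremum over \<open>{0..1}\<close> is
  turned into one over the whole line by clamping, so \<open>g\<close> and \<open>c\<close> are both the clamping map,
  and \<open>B = {0..}\<close> accounts for \<open>{0..x} = {0..} \<inter> {..x}\<close>.
\<close>

lemma borel_measurable_SUP_empirical_deviation:
  fixes g c :: "real \<Rightarrow> real"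
  assumes g: "mono g" "continuous_on UNIV g"
    and c: "continuous_on UNIV c" "\<And>x. 0 \<le> c x" "\<And>x. c x \<le> 1"
    and [measurable]: "B \<in> sets borel"
    and [measurable]: "\<And>i. i \<in> {1..n} \<Longrightarrow> X i \<in> borel_measurable M"
  shows "(\<lambda>\<omega>. SUP x. \<bar>(1 / real n) * (\<Sum>i=1..n. indicator (B \<inter> {..g x}) (X i \<omega>)) - c x\<bar>)
           \<in> borel_measurable M"
proof (rule borel_measurable_SUP_right_continuous)
  fix x
  show "(\<lambda>\<omega>. \<bar>(1 / real n) * (\<Sum>i=1..n. indicator (B \<inter> {..g x}) (X i \<omega>)) - c x\<bar>)
          \<in> borel_measurable M"
    by measurable
  fix \<omega>
  have "continuous (at_right x) c"
    using c(1) by (auto simp: continuous_on_eq_continuous_within intro: continuous_within_subset)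
  then show "continuous (at_right x)
          (\<lambda>x. \<bar>(1 / real n) * (\<Sum>i=1..n. indicator (B \<inter> {..g x}) (X i \<omega>)) - c x\<bar>)"
    by (intro continuous_rabs continuous_diff continuous_mult continuous_sum continuous_const
        continuous_at_right_indicator_atMost[OF g])
next
  fix \<omega>
  show "bdd_above (range (\<lambda>x. \<bar>(1 / real n) * (\<Sum>i=1..n. indicator (B \<inter> {..g x}) (X i \<omega>)) - c x\<bar>))"
    by (rule bdd_aboveI2[OF empirical_deviation_le_1[OF c(2,3)]])
qed

lemma borel_measurable_KS_stat:
  assumes "real_distribution \<mu>" "continuous_on UNIV (cdf \<mu>)"
  shows "KS_stat n (cdf \<mu>) \<in> borel_measurable (\<Pi>\<^sub>M i\<in>{1..n}. \<mu>)"
proof -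
  interpret real_distribution \<mu> by fact
  have "(\<lambda>\<eta>. \<eta> i) \<in> borel_measurable (\<Pi>\<^sub>M i\<in>{1..n}. \<mu>)" if "i \<in> {1..n}" for i
    using measurable_component_singleton[OF that, of "\<lambda>_. \<mu>"]
    by (simp only: measurable_cong_sets[OF refl events_eq_borel])
  then have "(\<lambda>\<eta>. SUP x. \<bar>(1 / real n) * (\<Sum>i=1..n. indicator (UNIV \<inter> {..x}) (\<eta> i)) - cdf \<mu> x\<bar>)
      \<in> borel_measurable (\<Pi>\<^sub>M i\<in>{1..n}. \<mu>)"
    using assms(2) cdf_nonneg cdf_bounded_prob
    by (intro borel_measurable_SUP_empirical_deviation[where g = "\<lambda>x. x" and c = "cdf \<mu>" and B = UNIV
          and X = "\<lambda>i \<eta>. \<eta> i"]) (auto simp: mono_def)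
  then show ?thesis
    unfolding KS_stat_def[abs_def] Int_UNIV_left .
qed


section \<open>Reduction to a uniform sample\<close>

definition uniform_KS_stat :: "nat \<Rightarrow> (nat \<Rightarrow> real) \<Rightarrow> real" where
  "uniform_KS_stat n u = (SUP x\<in>{0..1}. \<bar>(1 / real n) * (\<Sum>i=1..n. indicator {0..x} (u i)) - x\<bar>)"

lemma KS_cond_stat_eq_uniform_KS_stat:
  "KS_cond_stat n f z y = uniform_KS_stat n (\<lambda>i. cond_cdf f (z i) (y i))"
  by (simp add: KS_cond_stat_def uniform_KS_stat_def)

lemma uniform_KS_stat_cong:
  assumes "\<And>i. i \<in> {1..n} \<Longrightarrow> u i = v i"
  shows "uniform_KS_stat n u = uniform_KS_stat n v"
proof -
  have "(\<Sum>i=1..n. indicator S (u i)) = (\<Sum>i=1..n. indicator S (v i) :: real)" for S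
    using assms by (intro sum.cong) auto
  then show ?thesis by (simp only: uniform_KS_stat_def)
qed

lemma borel_measurable_uniform_KS_stat:
  "uniform_KS_stat n \<in> borel_measurable (\<Pi>\<^sub>M i\<in>{1..n}. borel)"
proof -
  let ?c = "\<lambda>x::real. max 0 (min 1 x)"
  have im: "range ?c = {0..1}"
  proof (intro antisym subsetI)
    fix x :: real assume "x \<in> {0..1}"
    then have "x = ?c x" by simp
    then show "x \<in> range ?c" by blast
  qed auto
  have eq: "uniform_KS_stat n =
      (\<lambda>u. SUP x. \<bar>(1 / real n) * (\<Sum>i=1..n. indicator ({0..} \<inter> {..?c x}) (u i)) - ?c x\<bar>)"
    unfolding uniform_KS_stat_def[abs_def] im[symmetric] image_image
    by (simp add: atLeastAtMost_def)
  show ?thesis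
    unfolding eq
  proof (rule borel_measurable_SUP_empirical_deviation[where g = ?c and c = ?c and B = "{0..}"
        and X = "\<lambda>i u. u i"])
    show "mono ?c" by (auto simp: mono_def)
    show "continuous_on UNIV ?c" "continuous_on UNIV ?c" by (intro continuous_intros)+
    show "0 \<le> ?c x" "?c x \<le> 1" for x :: real by simp_all
    show "(\<lambda>u. u i) \<in> borel_measurable (\<Pi>\<^sub>M i\<in>{1..n}. borel)" if "i \<in> {1..n}" for i
      using that by (rule measurable_component_singleton)
  qed simp
qed

text \<open>
  Under the hypothesis \<open>less\<close>, \<open>\<eta>\<^sub>i \<le> x\<close> is equivalent to \<open>F \<eta>\<^sub>i \<le> F x\<close>, so the classical
  statistic is the supremum of the deviation \<open>A t\<close> of the transformed sample over the range of
  \<open>F\<close>. That range contains \<open>(0, 1)\<close> but possibly not the end points; there \<open>A\<close> vanishes, as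
  all values \<open>F \<eta>\<^sub>i\<close> lie in \<open>(0, 1]\<close>, so adding them does not change the supremum.
\<close>

lemma KS_stat_eq_uniform_KS_stat:
  assumes "real_distribution \<mu>" and cont: "continuous_on UNIV (cdf \<mu>)" and n: "n \<ge> 1"
    and less: "\<And>i x. i \<in> {1..n} \<Longrightarrow> x < \<eta> i \<Longrightarrow> cdf \<mu> x < cdf \<mu> (\<eta> i)"
  shows "KS_stat n (cdf \<mu>) \<eta> = uniform_KS_stat n (\<lambda>i. cdf \<mu> (\<eta> i))"
proof -
  interpret real_distribution \<mu> by fact
  define A where "A t = \<bar>(1 / real n) * (\<Sum>i=1..n. indicator {0..t} (cdf \<mu> (\<eta> i))) - t\<bar>" for t
  have ind: "indicator {..x} (\<eta> i) = (indicator {0..cdf \<mu> x} (cdf \<mu> (\<eta> i)) :: real)"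
    if "i \<in> {1..n}" for i x
  proof -
    have "\<eta> i \<le> x \<longleftrightarrow> cdf \<mu> (\<eta> i) \<le> cdf \<mu> x"
      using less[OF that, of x] cdf_nondecreasing[of "\<eta> i" x] by linarith
    then show ?thesis using cdf_nonneg by (simp add: indicator_def)
  qed
  have KS: "KS_stat n (cdf \<mu>) \<eta> = (SUP x. A (cdf \<mu> x))"
  proof -
    have "(\<Sum>i=1..n. indicator {..x} (\<eta> i)) =
        (\<Sum>i=1..n. indicator {0..cdf \<mu> x} (cdf \<mu> (\<eta> i)) :: real)" for x
      by (intro sum.cong refl ind)
    then show ?thesis by (simp only: KS_stat_def A_def)
  qed
  have bddA: "A t \<le> 1" if "t \<in> {0..1}" for t
    unfolding A_def using that by (intro empirical_deviation_le_1) auto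
  have inF: "cdf \<mu> x \<in> {0..1}" for x using cdf_nonneg cdf_bounded_prob by auto
  have bdd: "bdd_above (A ` {0..1})" "bdd_above (range (\<lambda>x. A (cdf \<mu> x)))"
    by (rule bdd_aboveI2[OF bddA], assumption) (rule bdd_aboveI2[OF bddA[OF inF]])
  have pos: "0 < cdf \<mu> (\<eta> i)" if "i \<in> {1..n}" for i
    using less[OF that, of "\<eta> i - 1"] cdf_nonneg[of "\<eta> i - 1"] by linarith
  have "(\<Sum>i=1..n. indicator {0..0} (cdf \<mu> (\<eta> i))) = (0::real)"
    using pos by (intro sum.neutral) (auto simp: indicator_def less_le)
  then have A0: "A 0 = 0" by (simp add: A_def)
  have "(\<Sum>i=1..n. indicator {0..1} (cdf \<mu> (\<eta> i))) = (\<Sum>i=1..n. 1 :: real)"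
    using inF by (intro sum.cong) (auto simp: indicator_def)
  then have A1: "A 1 = 0" using n by (simp add: A_def)
  have "(SUP x. A (cdf \<mu> x)) = (SUP t\<in>{0..1}. A t)"
  proof (rule antisym)
    show "(SUP x. A (cdf \<mu> x)) \<le> (SUP t\<in>{0..1}. A t)"
      by (intro cSUP_least cSUP_upper[OF inF bdd(1)]) simp
    show "(SUP t\<in>{0..1}. A t) \<le> (SUP x. A (cdf \<mu> x))"
    proof (rule cSUP_least)
      fix t :: real assume t: "t \<in> {0..1}"
      consider "t = 0" | "t = 1" | "0 < t" "t < 1" using t by force
      then show "A t \<le> (SUP x. A (cdf \<mu> x))"
      proof cases
        case 3
        then obtain x where "cdf \<mu> x = t" using ex_cdf_eq[OF assms(1,2)] by blast
        then show ?thesis using cSUP_upper[OF UNIV_I bdd(2), of x] by simp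
      next
        case 1
        have "0 \<le> A (cdf \<mu> 0)" by (simp add: A_def)
        then show ?thesis using 1 A0 cSUP_upper[OF UNIV_I bdd(2), of 0] by simp
      next
        case 2
        have "0 \<le> A (cdf \<mu> 0)" by (simp add: A_def)
        then show ?thesis using 2 A1 cSUP_upper[OF UNIV_I bdd(2), of 0] by simp
      qed
    qed auto
  qed
  then show ?thesis by (simp add: KS uniform_KS_stat_def A_def)
qed

text \<open>
  By lemma \<open>AE_cdf_less\<close> almost every sample satisfies the hypothesis of the preceding lemma, and
  applying \<open>F\<close> to each coordinate maps the product law to the product of the image laws. As the
  image law is uniform by the probability integral transform, this is the classical fact that
  the law of the statistic does not depend on the continuous CDF.
\<close>

lemma distr_KS_stat_eq:
  assumes \<mu>: "real_distribution \<mu>" "continuous_on UNIV (cdf \<mu>)" and n: "n \<ge> 1"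
  shows "distr (\<Pi>\<^sub>M i\<in>{1..n}. \<mu>) borel (KS_stat n (cdf \<mu>)) =
     distr (\<Pi>\<^sub>M i\<in>{1..n}. distr \<mu> borel (cdf \<mu>)) borel (uniform_KS_stat n)"
proof -
  interpret real_distribution \<mu> by fact
  let ?P = "\<Pi>\<^sub>M i\<in>{1..n}. \<mu>"
  let ?B = "\<Pi>\<^sub>M i\<in>{1..n}. borel :: real measure"
  have F: "cdf \<mu> \<in> \<mu> \<rightarrow>\<^sub>M borel"
    using borel_measurable_continuous_onI[OF \<mu>(2)] by simp
  (* an arbitrary probability measure on the Borel sets: images of product measures are
     taken between products of probability measures, but on the target side only the
     sigma-algebra matters *)
  let ?\<rho> = "return borel (0 :: real)"
  have sets: "sets (\<Pi>\<^sub>M i\<in>{1..n}. ?\<rho>) = sets ?B"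
    by (intro sets_PiM_cong) auto
  have comp: "compose {1..n} (cdf \<mu>) \<in> ?P \<rightarrow>\<^sub>M ?B"
    unfolding compose_def
    by (rule measurable_restrict, rule measurable_compose[OF _ F], rule measurable_component_singleton)
  have "distr ?P (\<Pi>\<^sub>M i\<in>{1..n}. ?\<rho>) (compose {1..n} (cdf \<mu>)) = (\<Pi>\<^sub>M i\<in>{1..n}. distr \<mu> ?\<rho> (cdf \<mu>))"
    by (rule distr_PiM_finite_prob_space') (auto intro: prob_space_axioms prob_space_return F)
  also have "distr ?P (\<Pi>\<^sub>M i\<in>{1..n}. ?\<rho>) (compose {1..n} (cdf \<mu>)) = distr ?P ?B (compose {1..n} (cdf \<mu>))"
    by (rule distr_cong[OF refl sets refl])
  also have "distr \<mu> ?\<rho> (cdf \<mu>) = distr \<mu> borel (cdf \<mu>)"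
    by (rule distr_cong) auto
  finally have push: "distr ?P ?B (compose {1..n} (cdf \<mu>)) = (\<Pi>\<^sub>M i\<in>{1..n}. distr \<mu> borel (cdf \<mu>))" .
  have "AE \<eta> in ?P. \<forall>x<\<eta> i. cdf \<mu> x < cdf \<mu> (\<eta> i)" if "i \<in> {1..n}" for i
    using AE_PiM_component[of "{1..n}" "\<lambda>_. \<mu>" i "\<lambda>s. \<forall>x<s. cdf \<mu> x < cdf \<mu> s"]
      that AE_cdf_less[OF \<mu>] prob_space_axioms by simp
  then have "AE \<eta> in ?P. \<forall>i\<in>{1..n}. \<forall>x<\<eta> i. cdf \<mu> x < cdf \<mu> (\<eta> i)"
    by (intro AE_finite_allI) auto
  then have ae: "AE \<eta> in ?P. KS_stat n (cdf \<mu>) \<eta> = uniform_KS_stat n (compose {1..n} (cdf \<mu>) \<eta>)"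
  proof eventually_elim
    case (elim \<eta>)
    then have "KS_stat n (cdf \<mu>) \<eta> = uniform_KS_stat n (\<lambda>i. cdf \<mu> (\<eta> i))"
      by (intro KS_stat_eq_uniform_KS_stat[OF \<mu> n]) blast
    also have "\<dots> = uniform_KS_stat n (compose {1..n} (cdf \<mu>) \<eta>)"
      by (rule uniform_KS_stat_cong) (simp add: compose_def)
    finally show ?case .
  qed
  have "distr ?P borel (KS_stat n (cdf \<mu>)) =
      distr ?P borel (uniform_KS_stat n \<circ> compose {1..n} (cdf \<mu>))"
    using ae by (intro distr_cong_AE refl borel_measurable_KS_stat \<mu>
        measurable_comp[OF comp borel_measurable_uniform_KS_stat]) simp
  also have "\<dots> = distr (distr ?P ?B (compose {1..n} (cdf \<mu>))) borel (uniform_KS_stat n)"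
    by (rule distr_distr[symmetric, OF borel_measurable_uniform_KS_stat comp])
  finally show ?thesis unfolding push .
qed


section \<open>Conditional densities\<close>

lemma cond_cdf_eq_cdf_density:
  assumes [measurable]: "(\<lambda>s. f s u) \<in> borel_measurable borel"
    and nonneg: "\<And>s. 0 \<le> f s u" and total: "(\<integral>\<^sup>+ s. ennreal (f s u) \<partial>lborel) = 1"
  defines "\<mu> \<equiv> density lborel (\<lambda>s. ennreal (f s u))"
  shows "real_distribution \<mu>" "continuous_on UNIV (cdf \<mu>)" "cdf \<mu> = cond_cdf f u"
    "0 \<le> cond_cdf f u x" "emeasure \<mu> {..x} = ennreal (cond_cdf f u x)"
proof -
  interpret prob_space \<mu>
    by (rule prob_spaceI) (simp add: \<mu>_def emeasure_density total)
  show "real_distribution \<mu>"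
    by unfold_locales (simp_all add: \<mu>_def)
  then interpret real_distribution \<mu> .
  have "emeasure \<mu> {x} = 0" for x
    unfolding \<mu>_def
    by (subst emeasure_density, simp, simp, subst nn_integral_0_iff_AE, simp)
       (use AE_lborel_singleton[of x] in \<open>auto elim!: eventually_mono simp: indicator_def\<close>)
  then show "continuous_on UNIV (cdf \<mu>)"
    by (simp add: continuous_on_eq_continuous_at isCont_cdf measure_def)
  have int: "integrable lborel (\<lambda>s. f s u)"
    using nonneg total by (intro integrableI_nonneg) auto
  show nn: "0 \<le> cond_cdf f u x" for x
    unfolding cond_cdf_def set_lebesgue_integral_def
    by (intro Bochner_Integration.integral_nonneg) (simp add: nonneg)
  show eq: "emeasure \<mu> {..x} = ennreal (cond_cdf f u x)" for x
  proof -
    have "emeasure \<mu> {..x} = (\<integral>\<^sup>+ s. ennreal (indicator {..x} s *\<^sub>R f s u) \<partial>lborel)"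
      unfolding \<mu>_def
      by (subst emeasure_density, simp, simp)
         (auto intro!: nn_integral_cong simp: indicator_def)
    also have "\<dots> = ennreal (cond_cdf f u x)"
      unfolding cond_cdf_def set_lebesgue_integral_def
      using nonneg by (intro nn_integral_eq_integral integrable_mult_indicator int) auto
    finally show ?thesis .
  qed
  show "cdf \<mu> = cond_cdf f u"
    using nn by (simp add: fun_eq_iff cdf_def measure_def eq)
qed

lemma borel_measurable_cond_cdf_pair:
  assumes f: "(\<lambda>(s, u). f s u) \<in> borel_measurable (borel \<Otimes>\<^sub>M borel)"
  shows "(\<lambda>(u, x). cond_cdf f u x) \<in> borel_measurable (borel \<Otimes>\<^sub>M borel)"
proof -
  have [measurable]: "(\<lambda>p. f (snd p) (fst (fst p))) \<in> borel_measurable ((borel \<Otimes>\<^sub>M borel) \<Otimes>\<^sub>M lborel)"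
  proof -
    have "(\<lambda>p. (snd p, fst (fst p))) \<in> (borel \<Otimes>\<^sub>M borel) \<Otimes>\<^sub>M lborel \<rightarrow>\<^sub>M borel \<Otimes>\<^sub>M (borel :: real measure)"
      by measurable
    from measurable_compose[OF this f] show ?thesis by simp
  qed
  have "(\<lambda>p. if snd p \<le> snd (fst p) then f (snd p) (fst (fst p)) else 0)
          \<in> borel_measurable ((borel \<Otimes>\<^sub>M borel) \<Otimes>\<^sub>M lborel)"
    by measurable
  also have "(\<lambda>p. if snd p \<le> snd (fst p) then f (snd p) (fst (fst p)) else 0) =
      (\<lambda>(q, s). indicator {..snd q} s *\<^sub>R f s (fst q))"
    by (auto simp: fun_eq_iff indicator_def)
  finally have "(\<lambda>(q, s). indicator {..snd q} s *\<^sub>R f s (fst q))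
          \<in> borel_measurable ((borel \<Otimes>\<^sub>M borel) \<Otimes>\<^sub>M lborel)" .
  then have "(\<lambda>q. LINT s|lborel. indicator {..snd q} s *\<^sub>R f s (fst q)) \<in> borel_measurable (borel \<Otimes>\<^sub>M borel)"
    by (rule lborel.borel_measurable_lebesgue_integral)
  then show ?thesis
    by (simp add: cond_cdf_def set_lebesgue_integral_def case_prod_unfold)
qed

text \<open>
  Fubini: the joint law with density \<open>f(s, u)\<close> is the mixture over \<open>\<nu>\<close> of the laws with density
  \<open>f(\<cdot>, u)\<close>.
\<close>

lemma emeasure_density_pair_lborel:
  fixes f :: "real \<Rightarrow> real \<Rightarrow> real"
  assumes f: "(\<lambda>(s, u). f s u) \<in> borel_measurable (borel \<Otimes>\<^sub>M borel)"
    and \<nu>: "sets \<nu> = sets borel" and S: "S \<in> sets (borel \<Otimes>\<^sub>M borel)"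
  shows "emeasure (density (\<nu> \<Otimes>\<^sub>M lborel) (\<lambda>(u, s). ennreal (f s u))) S =
           (\<integral>\<^sup>+ u. emeasure (density lborel (\<lambda>s. ennreal (f s u))) {s. (u, s) \<in> S} \<partial>\<nu>)"
proof -
  have sets: "sets (\<nu> \<Otimes>\<^sub>M lborel) = sets (borel \<Otimes>\<^sub>M (borel :: real measure))"
    by (intro sets_pair_measure_cong) (auto simp: \<nu>)
  have "(\<lambda>p::real \<times> real. (snd p, fst p)) \<in> borel \<Otimes>\<^sub>M borel \<rightarrow>\<^sub>M borel \<Otimes>\<^sub>M borel"
    by measurable
  from measurable_compose[OF this f]
  have fm: "(\<lambda>(u, s). ennreal (f s u)) \<in> borel_measurable (\<nu> \<Otimes>\<^sub>M lborel)"
    unfolding measurable_cong_sets[OF sets refl] by (simp add: case_prod_unfold)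
  have S': "S \<in> sets (\<nu> \<Otimes>\<^sub>M lborel)" using S sets by simp
  have sec: "(\<lambda>s. f s u) \<in> borel_measurable borel" "{s. (u, s) \<in> S} \<in> sets borel" for u
    using measurable_compose[OF _ f, of "\<lambda>s. (s, u)" borel]
      measurable_sets[OF _ S, of "\<lambda>s. (u, s)" borel] by (simp_all add: vimage_def)
  have "emeasure (density (\<nu> \<Otimes>\<^sub>M lborel) (\<lambda>(u, s). ennreal (f s u))) S =
      (\<integral>\<^sup>+ p. (case p of (u, s) \<Rightarrow> ennreal (f s u)) * indicator S p \<partial>(\<nu> \<Otimes>\<^sub>M lborel))"
    by (rule emeasure_density[OF fm S'])
  also have "\<dots> = (\<integral>\<^sup>+ u. \<integral>\<^sup>+ s. ennreal (f s u) * indicator S (u, s) \<partial>lborel \<partial>\<nu>)"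
    using fm S' by (subst lborel.nn_integral_fst[symmetric]) (auto intro: borel_measurable_times_ennreal)
  also have "\<dots> = (\<integral>\<^sup>+ u. emeasure (density lborel (\<lambda>s. ennreal (f s u))) {s. (u, s) \<in> S} \<partial>\<nu>)"
    using sec by (intro nn_integral_cong, subst emeasure_density)
      (auto intro!: nn_integral_cong simp: indicator_def)
  finally show ?thesis .
qed


section \<open>A generator of the Borel sets of the plane\<close>

text \<open>
  Conditional laws are prescribed through CDFs only, that is on half-lines in the second
  coordinate. The whole line is added to the half-lines because the criterion for independence
  of finitely many variables needs generators that contain the full space.
\<close>

lemma sets_borel_prod_atMost:
  "sets (borel \<Otimes>\<^sub>M borel) =
     sigma_sets UNIV {C \<times> A | C A. C \<in> sets (borel :: 'a :: topological_space measure) \<and>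
       A \<in> insert UNIV (range (atMost :: real \<Rightarrow> _))}"
proof -
  let ?E = "insert UNIV (range (atMost :: real \<Rightarrow> _))"
  have B: "sets borel = sigma_sets (space borel) ?E"
  proof -
    have "sets (borel :: real measure) = sigma_sets UNIV (range atMost)"
      by (subst borel_eq_atMost) simp
    moreover have "sigma_sets UNIV ?E = sigma_sets UNIV (range (atMost :: real \<Rightarrow> _))"
      by (intro sigma_sets_eqI) (auto intro: sigma_sets_top sigma_sets.Basic)
    ultimately show ?thesis by simp
  qed
  have "sets (borel \<Otimes>\<^sub>M borel) = sets (sigma (space borel \<times> space borel)
      {C \<times> A | C A. C \<in> sets (borel :: 'a measure) \<and> A \<in> ?E})"
    by (rule sets_pair_eq[where Ca = "{UNIV}" and Cb = "{UNIV}"])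
       (auto simp: B sets.sigma_sets_eq[of borel, simplified])
  then show ?thesis by simp
qed

lemma Int_stable_prod_atMost:
  "Int_stable {C \<times> A | C A. C \<in> sets (borel :: 'a :: topological_space measure) \<and>
       A \<in> insert UNIV (range (atMost :: real \<Rightarrow> _))}"
  (is "Int_stable ?E")
proof (rule Int_stableI)
  fix a b assume "a \<in> ?E" "b \<in> ?E"
  then obtain C A C' A' where eq: "a = C \<times> A" "b = C' \<times> A'"
    and C: "C \<in> sets borel" "C' \<in> sets borel"
    and A: "A \<in> insert UNIV (range atMost)" "A' \<in> insert UNIV (range atMost)"
    by blast
  have "A \<inter> A' \<in> insert UNIV (range atMost)"
    using A by auto
  moreover have "a \<inter> b = (C \<inter> C') \<times> (A \<inter> A')" using eq by auto
  ultimately show "a \<inter> b \<in> ?E"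
    using C sets.Int by blast
qed


section \<open>Independence and law of the pairs\<close>

context prob_space
begin

lemma sigma_finite_subalgebra_gen_sigma:
  assumes "\<And>i. i \<in> {1..n} \<Longrightarrow> \<zeta> i \<in> borel_measurable M"
  shows "sigma_finite_subalgebra M (gen_sigma M n \<zeta>)"
proof -
  have vec: "(\<lambda>\<omega>. \<lambda>i\<in>{1..n}. \<zeta> i \<omega>) \<in> measurable M (\<Pi>\<^sub>M i\<in>{1..n}. borel)"
    using assms by (intro measurable_restrict) auto
  have "sets (gen_sigma M n \<zeta>) \<subseteq> sets M"
    unfolding gen_sigma_def using vec
    by (auto simp: sets_vimage_algebra2 space_PiM dest: measurable_sets)
  then have "subalgebra M (gen_sigma M n \<zeta>)"
    by (simp add: subalgebra_def gen_sigma_def)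
  then show ?thesis
    by (intro finite_measure_subalgebra_is_sigma_finite finite_measure_subalgebra.intro
        finite_measure_subalgebra_axioms.intro finite_measure_axioms)
qed

lemma measurable_gen_sigma:
  assumes "i \<in> {1..n}"
  shows "\<zeta> i \<in> borel_measurable (gen_sigma M n \<zeta>)"
proof -
  have "(\<lambda>\<omega>. (\<lambda>i\<in>{1..n}. \<zeta> i \<omega>) i) \<in> borel_measurable (gen_sigma M n \<zeta>)"
    unfolding gen_sigma_def
    by (rule measurable_compose[OF measurable_vimage_algebra1 measurable_component_singleton])
       (use assms in \<open>auto simp: space_PiM\<close>)
  then show ?thesis using assms by simp
qed

text \<open>
  The defining property of conditional expectation, tested with the \<open>\<zeta>\<close>-measurable factor
  \<open>indicator C (\<zeta> i \<omega>)\<close>.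
\<close>

lemma prob_rectangle:
  assumes i: "i \<in> {1..n}" and \<zeta>: "\<And>i. i \<in> {1..n} \<Longrightarrow> \<zeta> i \<in> borel_measurable M"
    and [measurable]: "\<xi> i \<in> borel_measurable M" "k \<in> borel_measurable borel"
      "C \<in> sets borel" "A \<in> sets borel"
    and k: "AE \<omega> in M. real_cond_exp M (gen_sigma M n \<zeta>)
              (indicator {\<omega>' \<in> space M. \<xi> i \<omega>' \<in> A}) \<omega> = k (\<zeta> i \<omega>)"
  shows "integrable M (\<lambda>\<omega>. indicator C (\<zeta> i \<omega>) * k (\<zeta> i \<omega>))"
    and "prob {\<omega> \<in> space M. \<zeta> i \<omega> \<in> C \<and> \<xi> i \<omega> \<in> A} =
           (\<integral>\<omega>. indicator C (\<zeta> i \<omega>) * k (\<zeta> i \<omega>) \<partial>M)"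
proof -
  let ?I = "indicator {\<omega>' \<in> space M. \<xi> i \<omega>' \<in> A} :: 'a \<Rightarrow> real"
  interpret G: sigma_finite_subalgebra M "gen_sigma M n \<zeta>"
    by (rule sigma_finite_subalgebra_gen_sigma[OF \<zeta>])
  note [measurable] = \<zeta>[OF i]
  have IG: "(\<lambda>\<omega>. indicator C (\<zeta> i \<omega>) :: real) \<in> borel_measurable (gen_sigma M n \<zeta>)"
    by (rule measurable_compose[OF measurable_gen_sigma[OF i]]) simp
  have int: "integrable M (\<lambda>\<omega>. indicator C (\<zeta> i \<omega>) * ?I \<omega>)"
    by (rule integrable_const_bound[of _ 1]) (auto simp: indicator_def)
  have eq: "AE \<omega> in M. indicator C (\<zeta> i \<omega>) * real_cond_exp M (gen_sigma M n \<zeta>) ?I \<omega> =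
      indicator C (\<zeta> i \<omega>) * k (\<zeta> i \<omega>)"
    using k by eventually_elim simp
  note intg = G.real_cond_exp_intg[OF int IG]
  show "integrable M (\<lambda>\<omega>. indicator C (\<zeta> i \<omega>) * k (\<zeta> i \<omega>))"
    using integrable_cong_AE[OF _ _ eq] intg(1) by simp
  have "(\<integral>\<omega>. indicator C (\<zeta> i \<omega>) * ?I \<omega> \<partial>M) =
      (\<integral>\<omega>. indicator {\<omega> \<in> space M. \<zeta> i \<omega> \<in> C \<and> \<xi> i \<omega> \<in> A} \<omega> \<partial>M)"
    by (intro Bochner_Integration.integral_cong) (auto simp: indicator_def)
  also have "\<dots> = prob {\<omega> \<in> space M. \<zeta> i \<omega> \<in> C \<and> \<xi> i \<omega> \<in> A}"
    by (simp add: Int_absorb2 subset_eq)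
  finally have "prob {\<omega> \<in> space M. \<zeta> i \<omega> \<in> C \<and> \<xi> i \<omega> \<in> A} = (\<integral>\<omega>. indicator C (\<zeta> i \<omega>) * ?I \<omega> \<partial>M)" ..
  also have "\<dots> = (\<integral>\<omega>. indicator C (\<zeta> i \<omega>) * real_cond_exp M (gen_sigma M n \<zeta>) ?I \<omega> \<partial>M)"
    by (rule intg(2)[symmetric]) simp
  also have "\<dots> = (\<integral>\<omega>. indicator C (\<zeta> i \<omega>) * k (\<zeta> i \<omega>) \<partial>M)"
    by (intro integral_cong_AE eq) simp_all
  finally show "prob {\<omega> \<in> space M. \<zeta> i \<omega> \<in> C \<and> \<xi> i \<omega> \<in> A} =
           (\<integral>\<omega>. indicator C (\<zeta> i \<omega>) * k (\<zeta> i \<omega>) \<partial>M)" .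
qed

text \<open>
  Conditioning on all of \<open>\<zeta>\<close> turns the indicator of the \<open>\<xi>\<close>-event into the product of the
  \<open>k i (\<zeta> i \<omega>)\<close>. What remains is the expectation of a product whose \<open>i\<close>-th factor depends on
  \<open>\<zeta> i\<close> alone, and it factorises because the \<open>\<zeta> i\<close> are independent. The condition on \<open>k\<close>, that
  the conditional law of \<open>\<xi> i\<close> given the whole vector is a function of \<open>\<zeta> i\<close>, is what makes
  this work.
\<close>

lemma prob_box_eq_prod:
  assumes indep: "indep_vars (\<lambda>_. borel) \<zeta> {1..n}"
    and \<xi>: "\<And>i. i \<in> {1..n} \<Longrightarrow> \<xi> i \<in> borel_measurable M"
    and ci: "cond_indep_given M (gen_sigma M n \<zeta>) n \<xi>"
    and C: "\<And>i. i \<in> {1..n} \<Longrightarrow> C i \<in> sets borel"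
    and A: "\<And>i. i \<in> {1..n} \<Longrightarrow> A i \<in> sets borel"
    and kb: "\<And>i. i \<in> {1..n} \<Longrightarrow> k i \<in> borel_measurable borel"
    and k: "\<And>i. i \<in> {1..n} \<Longrightarrow> AE \<omega> in M. real_cond_exp M (gen_sigma M n \<zeta>)
              (indicator {\<omega>' \<in> space M. \<xi> i \<omega>' \<in> A i}) \<omega> = k i (\<zeta> i \<omega>)"
  shows "prob {\<omega> \<in> space M. \<forall>i\<in>{1..n}. \<zeta> i \<omega> \<in> C i \<and> \<xi> i \<omega> \<in> A i} =
           (\<Prod>i=1..n. prob {\<omega> \<in> space M. \<zeta> i \<omega> \<in> C i \<and> \<xi> i \<omega> \<in> A i})"
proof -
  let ?G = "gen_sigma M n \<zeta>"
  let ?I = "indicator {\<omega>' \<in> space M. \<forall>i\<in>{1..n}. \<xi> i \<omega>' \<in> A i} :: 'a \<Rightarrow> real"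
  have \<zeta>: "\<And>i. i \<in> {1..n} \<Longrightarrow> \<zeta> i \<in> borel_measurable M"
    using indep by (simp add: indep_vars_def)
  interpret G: sigma_finite_subalgebra M ?G
    by (rule sigma_finite_subalgebra_gen_sigma[OF \<zeta>])
  note [measurable] = \<zeta> \<xi> C A kb
  have [measurable]: "?I \<in> borel_measurable M" by measurable
  have IG: "(\<lambda>\<omega>. \<Prod>i=1..n. indicator (C i) (\<zeta> i \<omega>) :: real) \<in> borel_measurable ?G"
    by (intro borel_measurable_prod measurable_compose[OF measurable_gen_sigma]) auto
  have int: "integrable M (\<lambda>\<omega>. (\<Prod>i=1..n. indicator (C i) (\<zeta> i \<omega>)) * ?I \<omega>)"
    by (rule integrable_const_bound[of _ 1])
       (auto simp: abs_mult abs_prod intro!: mult_le_one prod_le_1)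
  have ci': "AE \<omega> in M. real_cond_exp M ?G ?I \<omega> =
      (\<Prod>i=1..n. real_cond_exp M ?G (indicator {\<omega>' \<in> space M. \<xi> i \<omega>' \<in> A i}) \<omega>)"
    using ci A unfolding cond_indep_given_def by blast
  have "AE \<omega> in M. \<forall>i\<in>{1..n}. real_cond_exp M ?G
      (indicator {\<omega>' \<in> space M. \<xi> i \<omega>' \<in> A i}) \<omega> = k i (\<zeta> i \<omega>)"
    using k by (intro AE_finite_allI) auto
  with ci' have eq: "AE \<omega> in M. (\<Prod>i=1..n. indicator (C i) (\<zeta> i \<omega>)) * real_cond_exp M ?G ?I \<omega> =
      (\<Prod>i=1..n. indicator (C i) (\<zeta> i \<omega>) * k i (\<zeta> i \<omega>))"
  proof eventually_elim
    case (elim \<omega>)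
    have "real_cond_exp M ?G ?I \<omega> = (\<Prod>i=1..n. k i (\<zeta> i \<omega>))"
      unfolding elim(1) using elim(2) by (intro prod.cong) auto
    then show ?case by (simp only: prod.distrib)
  qed
  have "(\<Prod>i=1..n. indicator (C i) (\<zeta> i \<omega>)) * ?I \<omega> =
      indicator {\<omega> \<in> space M. \<forall>i\<in>{1..n}. \<zeta> i \<omega> \<in> C i \<and> \<xi> i \<omega> \<in> A i} \<omega>" if "\<omega> \<in> space M" for \<omega>
    using that by (auto simp: indicator_def prod_zero_iff)
  then have "(\<integral>\<omega>. (\<Prod>i=1..n. indicator (C i) (\<zeta> i \<omega>)) * ?I \<omega> \<partial>M) =
      (\<integral>\<omega>. indicator {\<omega> \<in> space M. \<forall>i\<in>{1..n}. \<zeta> i \<omega> \<in> C i \<and> \<xi> i \<omega> \<in> A i} \<omega> \<partial>M)"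
    by (intro Bochner_Integration.integral_cong refl)
  also have "\<dots> = prob {\<omega> \<in> space M. \<forall>i\<in>{1..n}. \<zeta> i \<omega> \<in> C i \<and> \<xi> i \<omega> \<in> A i}"
    by (simp add: Int_absorb2 subset_eq)
  finally have "prob {\<omega> \<in> space M. \<forall>i\<in>{1..n}. \<zeta> i \<omega> \<in> C i \<and> \<xi> i \<omega> \<in> A i} =
      (\<integral>\<omega>. (\<Prod>i=1..n. indicator (C i) (\<zeta> i \<omega>)) * ?I \<omega> \<partial>M)" ..
  also have "\<dots> = (\<integral>\<omega>. (\<Prod>i=1..n. indicator (C i) (\<zeta> i \<omega>)) * real_cond_exp M ?G ?I \<omega> \<partial>M)"
    by (rule G.real_cond_exp_intg(2)[OF int IG, symmetric]) simp
  also have "\<dots> = (\<integral>\<omega>. (\<Prod>i=1..n. indicator (C i) (\<zeta> i \<omega>) * k i (\<zeta> i \<omega>)) \<partial>M)"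
    by (intro integral_cong_AE eq) measurable
  also have "\<dots> = (\<Prod>i=1..n. \<integral>\<omega>. indicator (C i) (\<zeta> i \<omega>) * k i (\<zeta> i \<omega>) \<partial>M)"
  proof (rule indep_vars_lebesgue_integral)
    show "indep_vars (\<lambda>_. borel) (\<lambda>i \<omega>. indicator (C i) (\<zeta> i \<omega>) * k i (\<zeta> i \<omega>)) {1..n}"
      by (rule indep_vars_compose2[OF indep, of "\<lambda>i u. indicator (C i) u * k i u"]) measurable
    show "integrable M (\<lambda>\<omega>. indicator (C i) (\<zeta> i \<omega>) * k i (\<zeta> i \<omega>))" if "i \<in> {1..n}" for i
      using that \<zeta> \<xi> C A kb k by (intro prob_rectangle(1)[where A = "A i" and \<xi> = \<xi>]) auto
  qed simp
  also have "\<dots> = (\<Prod>i=1..n. prob {\<omega> \<in> space M. \<zeta> i \<omega> \<in> C i \<and> \<xi> i \<omega> \<in> A i})"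
    using \<zeta> \<xi> C A kb k by (intro prod.cong refl prob_rectangle(2)[symmetric]) auto
  finally show ?thesis .
qed

text \<open>
  Conditional independence of the \<open>\<xi> i\<close> becomes ordinary independence once each \<open>\<xi> i\<close> is paired
  with its \<open>\<zeta> i\<close>: the factorisation on boxes extends from the generator of rectangles
  \<open>C \<times> {..x}\<close>.
\<close>

lemma indep_vars_pairs:
  assumes n: "n \<ge> 1" and indep: "indep_vars (\<lambda>_. borel) \<zeta> {1..n}"
    and \<xi>: "\<And>i. i \<in> {1..n} \<Longrightarrow> \<xi> i \<in> borel_measurable M"
    and ci: "cond_indep_given M (gen_sigma M n \<zeta>) n \<xi>"
    and Kb: "\<And>i x. i \<in> {1..n} \<Longrightarrow> K i x \<in> borel_measurable borel"
    and K: "\<And>i x. i \<in> {1..n} \<Longrightarrow> AE \<omega> in M. real_cond_exp M (gen_sigma M n \<zeta>)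
              (indicator {\<omega>' \<in> space M. \<xi> i \<omega>' \<le> x}) \<omega> = K i x (\<zeta> i \<omega>)"
  shows "indep_vars (\<lambda>_. borel \<Otimes>\<^sub>M borel) (\<lambda>i \<omega>. (\<zeta> i \<omega>, \<xi> i \<omega>)) {1..n}"
proof -
  let ?G = "gen_sigma M n \<zeta>"
  let ?T = "insert UNIV (range (atMost :: real \<Rightarrow> _))"
  let ?E = "{C \<times> A | C A. C \<in> sets (borel :: real measure) \<and> A \<in> ?T}"
  have \<zeta>: "\<And>i. i \<in> {1..n} \<Longrightarrow> \<zeta> i \<in> borel_measurable M"
    using indep by (simp add: indep_vars_def)
  interpret G: sigma_finite_subalgebra M ?G
    by (rule sigma_finite_subalgebra_gen_sigma[OF \<zeta>])
  have ex: "\<exists>k. k \<in> borel_measurable borel \<and> (AE \<omega> in M. real_cond_exp M ?G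
      (indicator {\<omega>' \<in> space M. \<xi> i \<omega>' \<in> A}) \<omega> = k (\<zeta> i \<omega>))"
    if i: "i \<in> {1..n}" and A: "A \<in> ?T" for i A
  proof (cases "A = UNIV")
    case True
    have "{\<omega>' \<in> space M. \<xi> i \<omega>' \<in> A} \<in> sets ?G"
      using True sets.top[of ?G] by (simp add: gen_sigma_def)
    then have "AE \<omega> in M. real_cond_exp M ?G (indicator {\<omega>' \<in> space M. \<xi> i \<omega>' \<in> A}) \<omega> =
        (indicator {\<omega>' \<in> space M. \<xi> i \<omega>' \<in> A} \<omega> :: real)"
      using True by (intro G.real_cond_exp_F_meas borel_measurable_indicator) 
        (auto intro!: integrable_real_indicator simp: emeasure_eq_measure)
    then have "AE \<omega> in M. real_cond_exp M ?G (indicator {\<omega>' \<in> space M. \<xi> i \<omega>' \<in> A}) \<omega> = (\<lambda>_. 1) (\<zeta> i \<omega>)"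
      by (rule AE_mp) (use True in \<open>auto intro!: AE_I2\<close>)
    then show ?thesis by (intro exI[of _ "\<lambda>_. 1"]) auto
  next
    case False
    then obtain x where "A = {..x}" using A by blast
    then show ?thesis using i Kb[of i x] K[of i x] by auto
  qed
  show ?thesis
  proof (subst indep_vars_finite[where E = "\<lambda>_. ?E"])
    show "\<forall>S\<in>{1..n} \<rightarrow> ?E. prob (\<Inter>j\<in>{1..n}. (\<lambda>\<omega>. (\<zeta> j \<omega>, \<xi> j \<omega>)) -` S j \<inter> space M) =
        (\<Prod>j=1..n. prob ((\<lambda>\<omega>. (\<zeta> j \<omega>, \<xi> j \<omega>)) -` S j \<inter> space M))"
    proof
      fix S assume "S \<in> {1..n} \<rightarrow> ?E"
      then have "\<forall>i\<in>{1..n}. \<exists>C A. S i = C \<times> A \<and> C \<in> sets borel \<and> A \<in> ?T"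
        by (auto simp: Pi_iff)
      then obtain C A where S: "\<And>i. i \<in> {1..n} \<Longrightarrow> S i = C i \<times> A i"
        and C: "\<And>i. i \<in> {1..n} \<Longrightarrow> C i \<in> sets borel" and A: "\<And>i. i \<in> {1..n} \<Longrightarrow> A i \<in> ?T"
        by metis
      have Ab: "A i \<in> sets borel" if "i \<in> {1..n}" for i using A[OF that] by auto
      have "\<forall>i\<in>{1..n}. \<exists>k. k \<in> borel_measurable borel \<and> (AE \<omega> in M. real_cond_exp M ?G
            (indicator {\<omega>' \<in> space M. \<xi> i \<omega>' \<in> A i}) \<omega> = k (\<zeta> i \<omega>))"
        by (intro ballI ex A)
      from bchoice[OF this] obtain k where k: "\<And>i. i \<in> {1..n} \<Longrightarrow> k i \<in> borel_measurable borel"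
        "\<And>i. i \<in> {1..n} \<Longrightarrow> AE \<omega> in M. real_cond_exp M ?G
            (indicator {\<omega>' \<in> space M. \<xi> i \<omega>' \<in> A i}) \<omega> = k i (\<zeta> i \<omega>)"
        by metis
      have inter: "(\<Inter>j\<in>{1..n}. (\<lambda>\<omega>. (\<zeta> j \<omega>, \<xi> j \<omega>)) -` S j \<inter> space M) =
          {\<omega> \<in> space M. \<forall>i\<in>{1..n}. \<zeta> i \<omega> \<in> C i \<and> \<xi> i \<omega> \<in> A i}"
        using S n by auto
      have single: "(\<lambda>\<omega>. (\<zeta> j \<omega>, \<xi> j \<omega>)) -` S j \<inter> space M =
          {\<omega> \<in> space M. \<zeta> j \<omega> \<in> C j \<and> \<xi> j \<omega> \<in> A j}" if "j \<in> {1..n}" for j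
        using S[OF that] by auto
      have "prob (\<Inter>j\<in>{1..n}. (\<lambda>\<omega>. (\<zeta> j \<omega>, \<xi> j \<omega>)) -` S j \<inter> space M) =
          (\<Prod>i=1..n. prob {\<omega> \<in> space M. \<zeta> i \<omega> \<in> C i \<and> \<xi> i \<omega> \<in> A i})"
        unfolding inter by (rule prob_box_eq_prod[where k = k]) (fact indep \<xi> ci C Ab k)+
      also have "\<dots> = (\<Prod>j=1..n. prob ((\<lambda>\<omega>. (\<zeta> j \<omega>, \<xi> j \<omega>)) -` S j \<inter> space M))"
        by (rule prod.cong[OF refl]) (simp only: single)
      finally show "prob (\<Inter>j\<in>{1..n}. (\<lambda>\<omega>. (\<zeta> j \<omega>, \<xi> j \<omega>)) -` S j \<inter> space M) =
          (\<Prod>j=1..n. prob ((\<lambda>\<omega>. (\<zeta> j \<omega>, \<xi> j \<omega>)) -` S j \<inter> space M))" .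
    qed
  next
    fix i assume i: "i \<in> {1..n}"
    show "random_variable (borel \<Otimes>\<^sub>M borel) (\<lambda>\<omega>. (\<zeta> i \<omega>, \<xi> i \<omega>))"
      using \<zeta>[OF i] \<xi>[OF i] by measurable
    show "Int_stable ?E" by (rule Int_stable_prod_atMost)
    show "sets (borel \<Otimes>\<^sub>M borel) = sigma_sets (space (borel \<Otimes>\<^sub>M borel)) ?E"
      by (simp add: sets_borel_prod_atMost space_pair_measure)
    show "space (borel \<Otimes>\<^sub>M borel) \<in> ?E"
      by (auto simp: space_pair_measure intro!: exI[of _ UNIV])
    show "?E \<subseteq> Pow (space (borel \<Otimes>\<^sub>M borel))" by (auto simp: space_pair_measure)
  qed (use n in auto)
qed

text \<open>
  Both measures agree on rectangles \<open>C \<times> {..x}\<close>: the conditional CDF integrated over \<open>C\<close> is the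
  iterated integral of the density. Knowing the joint law, and not just the conditional CDF at
  each fixed \<open>x\<close>, is needed to evaluate the conditional CDF at the random point \<open>\<xi> i\<close>.
\<close>

lemma distr_pair_eq_density:
  assumes i: "i \<in> {1..n}" and \<zeta>: "\<And>i. i \<in> {1..n} \<Longrightarrow> \<zeta> i \<in> borel_measurable M"
    and \<xi>: "\<xi> i \<in> borel_measurable M"
    and \<nu>: "distr M borel (\<zeta> i) = \<nu>"
    and f: "conditional_pdf \<nu> f"
    and F: "\<And>x. AE \<omega> in M. real_cond_exp M (gen_sigma M n \<zeta>)
              (indicator {\<omega>' \<in> space M. \<xi> i \<omega>' \<le> x}) \<omega> = cond_cdf f (\<zeta> i \<omega>) x"
  shows "distr M (borel \<Otimes>\<^sub>M borel) (\<lambda>\<omega>. (\<zeta> i \<omega>, \<xi> i \<omega>)) =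
           density (\<nu> \<Otimes>\<^sub>M lborel) (\<lambda>(u, s). ennreal (f s u))"
    (is "?P = ?D")
proof -
  let ?E = "{C \<times> A | C A. C \<in> sets (borel :: real measure) \<and>
      A \<in> insert UNIV (range (atMost :: real \<Rightarrow> _))}"
  have f_meas: "(\<lambda>(s, u). f s u) \<in> borel_measurable (borel \<Otimes>\<^sub>M borel)"
    using f by (simp add: conditional_pdf_def)
  have good: "AE u in \<nu>. (\<forall>s. 0 \<le> f s u) \<and> (\<integral>\<^sup>+ s. ennreal (f s u) \<partial>lborel) = 1"
    using f by (simp add: conditional_pdf_def)
  note [measurable] = \<zeta>[OF i] \<xi>
  have sets_\<nu> [measurable_cong]: "sets \<nu> = sets borel" using \<nu> by auto
  have [simp]: "space \<nu> = UNIV" using \<nu> by auto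
  have sec [measurable]: "(\<lambda>s. f s u) \<in> borel_measurable borel" for u
    using measurable_compose[OF _ f_meas, of "\<lambda>s. (s, u)" borel] by simp
  have cc [measurable]: "(\<lambda>u. cond_cdf f u x) \<in> borel_measurable borel" for x
    by (rule borel_measurable_cond_cdf[OF f_meas])
  have eq: "emeasure ?P (C \<times> A) = emeasure ?D (C \<times> A)"
    if C: "C \<in> sets borel" and A: "A \<in> insert UNIV (range atMost)" for C A
  proof -
    have Ab: "A \<in> sets borel" using A by auto
    note [measurable] = C Ab
    have "emeasure ?P (C \<times> A) = emeasure M {\<omega> \<in> space M. \<zeta> i \<omega> \<in> C \<and> \<xi> i \<omega> \<in> A}"
      by (subst emeasure_distr) (auto intro!: arg_cong[where f = "emeasure M"])
    also have "\<dots> = (\<integral>\<^sup>+ u. emeasure (density lborel (\<lambda>s. ennreal (f s u))) A * indicator C u \<partial>\<nu>)"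
    proof (cases "A = UNIV")
      case True
      have "(\<integral>\<^sup>+ u. emeasure (density lborel (\<lambda>s. ennreal (f s u))) A * indicator C u \<partial>\<nu>) =
          (\<integral>\<^sup>+ u. indicator C u \<partial>\<nu>)"
        by (rule nn_integral_cong_AE, use good in eventually_elim)
           (simp add: True emeasure_density)
      also have "\<dots> = emeasure M {\<omega> \<in> space M. \<zeta> i \<omega> \<in> C \<and> \<xi> i \<omega> \<in> A}"
        by (simp add: \<nu>[symmetric] emeasure_distr True vimage_def Int_def conj_commute)
      finally show ?thesis ..
    next
      case False
      then obtain x where x: "A = {..x}" using A by blast
      have R: "AE \<omega> in M. real_cond_exp M (gen_sigma M n \<zeta>)
              (indicator {\<omega>' \<in> space M. \<xi> i \<omega>' \<in> A}) \<omega> = cond_cdf f (\<zeta> i \<omega>) x"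
        using F[of x] by (simp add: x)
      note rect = prob_rectangle[where \<zeta> = \<zeta> and \<xi> = \<xi>, OF i \<zeta> \<xi> cc C Ab R]
      have good': "AE u in \<nu>. 0 \<le> indicator C u * cond_cdf f u x \<and>
          emeasure (density lborel (\<lambda>s. ennreal (f s u))) A * indicator C u =
          ennreal (indicator C u * cond_cdf f u x)"
        using good
      proof eventually_elim
        case (elim u)
        then have "emeasure (density lborel (\<lambda>s. ennreal (f s u))) A = ennreal (cond_cdf f u x)"
          "0 \<le> cond_cdf f u x"
          using cond_cdf_eq_cdf_density(4,5)[of f u x] by (simp_all add: x)
        then show ?case by (simp add: indicator_def)
      qed
      have int: "integrable \<nu> (\<lambda>u. indicator C u * cond_cdf f u x)"
        unfolding \<nu>[symmetric] using rect(1) by (subst integrable_distr_eq) auto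
      have "(\<integral>\<^sup>+ u. emeasure (density lborel (\<lambda>s. ennreal (f s u))) A * indicator C u \<partial>\<nu>) =
          (\<integral>\<^sup>+ u. ennreal (indicator C u * cond_cdf f u x) \<partial>\<nu>)"
        by (rule nn_integral_cong_AE) (use good' in eventually_elim, simp)
      also have "\<dots> = ennreal (\<integral> u. indicator C u * cond_cdf f u x \<partial>\<nu>)"
        by (rule nn_integral_eq_integral[OF int]) (use good' in eventually_elim, simp)
      also have "(\<integral> u. indicator C u * cond_cdf f u x \<partial>\<nu>) =
          (\<integral>\<omega>. indicator C (\<zeta> i \<omega>) * cond_cdf f (\<zeta> i \<omega>) x \<partial>M)"
        unfolding \<nu>[symmetric] by (subst integral_distr) auto
      finally show ?thesis
        using rect(2) by (simp add: emeasure_eq_measure)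
    qed
    also have "\<dots> = emeasure ?D (C \<times> A)"
    proof (subst emeasure_density_pair_lborel[OF f_meas])
      show "(\<integral>\<^sup>+ u. emeasure (density lborel (\<lambda>s. ennreal (f s u))) A * indicator C u \<partial>\<nu>) =
          (\<integral>\<^sup>+ u. emeasure (density lborel (\<lambda>s. ennreal (f s u))) {s. (u, s) \<in> C \<times> A} \<partial>\<nu>)"
        by (intro nn_integral_cong) (auto simp: indicator_def)
    qed (use C Ab sets_\<nu> in auto)
    finally show ?thesis .
  qed
  show ?thesis
  proof (rule measure_eqI_generator_eq_countable[where E = ?E and \<Omega> = UNIV and A = "{UNIV}"])
    show "Int_stable ?E" by (rule Int_stable_prod_atMost)
    show "emeasure ?P X = emeasure ?D X" if "X \<in> ?E" for X using that eq by blast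
    show "sets ?P = sigma_sets UNIV ?E" by (simp add: sets_borel_prod_atMost)
    have "sets (\<nu> \<Otimes>\<^sub>M lborel) = sets (borel \<Otimes>\<^sub>M (borel :: real measure))"
      by (intro sets_pair_measure_cong sets_\<nu> sets_lborel)
    then show "sets ?D = sigma_sets UNIV ?E" by (simp add: sets_borel_prod_atMost)
    interpret P: prob_space ?P by (intro prob_space_distr) measurable
    show "emeasure ?P a \<noteq> \<infinity>" for a by simp
    show "{UNIV} \<subseteq> ?E" by (auto intro!: exI[of _ UNIV])
  qed auto
qed

end


section \<open>The law of the transformed variables\<close>

text \<open>
  Given \<open>Z = u\<close>, the variable \<open>Y\<close> has the density \<open>f(\<cdot>, u)\<close>, whose CDF is continuous; by the
  probability integral transform its value at \<open>Y\<close> is then uniform. This conditional law does not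
  depend on \<open>u\<close>, so averaging over \<open>u\<close> leaves it unchanged.
\<close>

lemma (in prob_space) prob_cond_cdf_le:
  assumes f: "conditional_pdf \<nu> f" and \<nu>: "distr M borel Z = \<nu>"
    and [measurable]: "Z \<in> borel_measurable M" "Y \<in> borel_measurable M"
    and law: "distr M (borel \<Otimes>\<^sub>M borel) (\<lambda>\<omega>. (Z \<omega>, Y \<omega>)) =
           density (\<nu> \<Otimes>\<^sub>M lborel) (\<lambda>(u, s). ennreal (f s u))"
  shows "prob {\<omega> \<in> space M. cond_cdf f (Z \<omega>) (Y \<omega>) \<le> t} = max 0 (min 1 t)"
proof -
  let ?S = "{p. (\<lambda>(u, x). cond_cdf f u x) p \<le> t}"
  have f_meas: "(\<lambda>(s, u). f s u) \<in> borel_measurable (borel \<Otimes>\<^sub>M borel)"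
    and good: "AE u in \<nu>. (\<forall>s. 0 \<le> f s u) \<and> (\<integral>\<^sup>+ s. ennreal (f s u) \<partial>lborel) = 1"
    using f by (simp_all add: conditional_pdf_def)
  have [measurable]: "(\<lambda>(u, x). cond_cdf f u x) \<in> borel_measurable (borel \<Otimes>\<^sub>M borel)"
    by (rule borel_measurable_cond_cdf_pair[OF f_meas])
  have "{p \<in> space (borel \<Otimes>\<^sub>M borel). (\<lambda>(u, x). cond_cdf f u x) p \<le> t} \<in> sets (borel \<Otimes>\<^sub>M borel)"
    by measurable
  then have S: "?S \<in> sets (borel \<Otimes>\<^sub>M borel)" by (simp add: space_pair_measure)
  interpret \<nu>: prob_space \<nu> unfolding \<nu>[symmetric] by (rule prob_space_distr) simp
  have "emeasure M {\<omega> \<in> space M. cond_cdf f (Z \<omega>) (Y \<omega>) \<le> t} =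
      emeasure (distr M (borel \<Otimes>\<^sub>M borel) (\<lambda>\<omega>. (Z \<omega>, Y \<omega>))) ?S"
    using S by (subst emeasure_distr) (auto intro!: arg_cong[where f = "emeasure M"])
  also have "\<dots> = (\<integral>\<^sup>+ u. emeasure (density lborel (\<lambda>s. ennreal (f s u))) {s. (u, s) \<in> ?S} \<partial>\<nu>)"
    unfolding law by (rule emeasure_density_pair_lborel[OF f_meas _ S]) (simp add: \<nu>[symmetric])
  also have "\<dots> = (\<integral>\<^sup>+ u. ennreal (max 0 (min 1 t)) \<partial>\<nu>)"
  proof (rule nn_integral_cong_AE, use good in eventually_elim)
    fix u assume u: "(\<forall>s. 0 \<le> f s u) \<and> (\<integral>\<^sup>+ s. ennreal (f s u) \<partial>lborel) = 1"
    have sec: "(\<lambda>s. f s u) \<in> borel_measurable borel"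
      using measurable_compose[OF _ f_meas, of "\<lambda>s. (s, u)" borel] by simp
    note D = cond_cdf_eq_cdf_density[of f u, OF sec]
    have "real_distribution (density lborel (\<lambda>s. ennreal (f s u)))"
      using D(1) u by simp
    then interpret u: real_distribution "density lborel (\<lambda>s. ennreal (f s u))" .
    have "measure (density lborel (\<lambda>s. ennreal (f s u))) {s. cond_cdf f u s \<le> t} = max 0 (min 1 t)"
      using measure_cdf_le[of "density lborel (\<lambda>s. ennreal (f s u))" t] D(1-3) u by simp
    then show "emeasure (density lborel (\<lambda>s. ennreal (f s u))) {s. (u, s) \<in> ?S} = ennreal (max 0 (min 1 t))"
      by (simp add: u.emeasure_eq_measure)
  qed
  also have "\<dots> = ennreal (max 0 (min 1 t))" by (simp add: \<nu>.emeasure_space_1)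
  finally have "ennreal (prob {\<omega> \<in> space M. cond_cdf f (Z \<omega>) (Y \<omega>) \<le> t}) = ennreal (max 0 (min 1 t))"
    by (simp only: emeasure_eq_measure)
  then show ?thesis by (subst (asm) ennreal_inj) auto
qed


section \<open>The conditional Kolmogorov-Smirnov statistic\<close>

theorem theorem4p5:
  fixes M :: "'a measure" and n :: nat and \<nu> :: "real measure"
    and f :: "real \<Rightarrow> real \<Rightarrow> real" and \<zeta> \<xi> :: "nat \<Rightarrow> 'a \<Rightarrow> real"
  assumes "prob_space M"
    and "n \<ge> 1"
    and "prob_space.indep_vars M (\<lambda>_. borel) \<zeta> {1..n}"
    and "\<And>i. i \<in> {1..n} \<Longrightarrow> distr M borel (\<zeta> i) = \<nu>"
    and "\<And>i. i \<in> {1..n} \<Longrightarrow> \<xi> i \<in> borel_measurable M"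
    and "conditional_pdf \<nu> f"
    and "cond_null_hypothesis M n f \<zeta> \<xi>"
    and "\<And>i. i \<in> {1..n} \<Longrightarrow> AE \<omega> in M. continuous_on UNIV (cond_cdf f (\<zeta> i \<omega>))"
  shows "KS_distributed n M (\<lambda>\<omega>. KS_cond_stat n f (\<lambda>i. \<zeta> i \<omega>) (\<lambda>i. \<xi> i \<omega>))"
proof -
  interpret prob_space M by fact
  define U where "U i \<omega> = cond_cdf f (\<zeta> i \<omega>) (\<xi> i \<omega>)" for i \<omega>
  let ?B = "\<Pi>\<^sub>M i\<in>{1..n}. borel :: real measure"
  let ?U = "\<lambda>\<omega>. \<lambda>i\<in>{1..n}. U i \<omega>"
  have f_meas: "(\<lambda>(s, u). f s u) \<in> borel_measurable (borel \<Otimes>\<^sub>M borel)"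
    using assms(6) by (simp add: conditional_pdf_def)
  have \<zeta>: "\<zeta> i \<in> borel_measurable M" if "i \<in> {1..n}" for i
    using assms(3) that by (simp add: indep_vars_def)
  have ci: "cond_indep_given M (gen_sigma M n \<zeta>) n \<xi>"
    and F: "\<And>i x. i \<in> {1..n} \<Longrightarrow> AE \<omega> in M. real_cond_exp M (gen_sigma M n \<zeta>)
        (indicator {\<omega>' \<in> space M. \<xi> i \<omega>' \<le> x}) \<omega> = cond_cdf f (\<zeta> i \<omega>) x"
    using assms(7) by (auto simp: cond_null_hypothesis_def)
  have pairs: "indep_vars (\<lambda>_. borel \<Otimes>\<^sub>M borel) (\<lambda>i \<omega>. (\<zeta> i \<omega>, \<xi> i \<omega>)) {1..n}"
  proof (rule indep_vars_pairs[where K = "\<lambda>i x u. cond_cdf f u x"])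
    show "(\<lambda>u. cond_cdf f u x) \<in> borel_measurable borel" for x
      by (rule borel_measurable_cond_cdf[OF f_meas])
    show "AE \<omega> in M. real_cond_exp M (gen_sigma M n \<zeta>)
        (indicator {\<omega>' \<in> space M. \<xi> i \<omega>' \<le> x}) \<omega> = cond_cdf f (\<zeta> i \<omega>) x"
      if "i \<in> {1..n}" for i x using that by (rule F)
  qed (fact assms(2,3,5) ci)+
  then have indep: "indep_vars (\<lambda>_. borel) U {1..n}"
    using indep_vars_compose2[OF pairs borel_measurable_cond_cdf_pair[OF f_meas]]
    by (simp add: U_def[abs_def])
  then have U: "U i \<in> borel_measurable M" if "i \<in> {1..n}" for i
    using that by (simp add: indep_vars_def)
  have cdfU: "prob {\<omega> \<in> space M. U i \<omega> \<le> t} = max 0 (min 1 t)" if i: "i \<in> {1..n}" for i t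
    unfolding U_def
    by (rule prob_cond_cdf_le[OF assms(6) assms(4)[OF i] \<zeta>[OF i] assms(5)[OF i]])
       (rule distr_pair_eq_density[where \<zeta> = \<zeta> and \<xi> = \<xi>, OF i \<zeta> assms(5)[OF i] assms(4)[OF i] assms(6) F[OF i]])
  have Um: "?U \<in> M \<rightarrow>\<^sub>M ?B"
    using U by (intro measurable_restrict)
  have S: "KS_cond_stat n f (\<lambda>i. \<zeta> i \<omega>) (\<lambda>i. \<xi> i \<omega>) = uniform_KS_stat n (?U \<omega>)" for \<omega>
    unfolding KS_cond_stat_eq_uniform_KS_stat by (rule uniform_KS_stat_cong) (simp add: U_def)
  have distU: "distr M ?B ?U = (\<Pi>\<^sub>M i\<in>{1..n}. distr M borel (U i))"
    using indep_vars_iff_distr_eq_PiM'[of "{1..n}" U "\<lambda>_. borel"] indep U assms(2) by simp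
  show ?thesis
    unfolding KS_distributed_def S
  proof (intro conjI allI impI)
    show "(\<lambda>\<omega>. uniform_KS_stat n (?U \<omega>)) \<in> borel_measurable M"
      by (rule measurable_compose[OF Um borel_measurable_uniform_KS_stat])
    fix \<mu> assume "real_distribution \<mu> \<and> continuous_on UNIV (cdf \<mu>)"
    then have \<mu>: "real_distribution \<mu>" "continuous_on UNIV (cdf \<mu>)" by auto
    interpret \<mu>: real_distribution \<mu> by fact
    have F\<mu>: "cdf \<mu> \<in> \<mu> \<rightarrow>\<^sub>M borel"
      using borel_measurable_continuous_onI[OF \<mu>(2)] by simp
    have same: "distr M borel (U i) = distr \<mu> borel (cdf \<mu>)" if i: "i \<in> {1..n}" for i
    proof (rule real_distribution_eqI_clamp)
      show "real_distribution (distr M borel (U i))"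
        by (rule real_distribution_distr[OF U[OF i]])
      show "real_distribution (distr \<mu> borel (cdf \<mu>))"
        by (rule \<mu>.real_distribution_distr[OF F\<mu>])
      show "measure (distr M borel (U i)) {..t} = max 0 (min 1 t)" for t
        using cdfU[OF i, of t] U[OF i] by (simp add: measure_distr vimage_def Int_def conj_commute)
      show "measure (distr \<mu> borel (cdf \<mu>)) {..t} = max 0 (min 1 t)" for t
        by (rule measure_distr_cdf_atMost[OF \<mu>])
    qed
    have "distr M borel (\<lambda>\<omega>. uniform_KS_stat n (?U \<omega>)) =
        distr (distr M ?B ?U) borel (uniform_KS_stat n)"
      unfolding distr_distr[OF borel_measurable_uniform_KS_stat Um] comp_def ..
    also have "distr M ?B ?U = (\<Pi>\<^sub>M i\<in>{1..n}. distr \<mu> borel (cdf \<mu>))"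
      unfolding distU using same by (intro PiM_cong) auto
    also have "distr \<dots> borel (uniform_KS_stat n) =
        distr (\<Pi>\<^sub>M i\<in>{1..n}. \<mu>) borel (KS_stat n (cdf \<mu>))"
      by (rule distr_KS_stat_eq[OF \<mu> assms(2), symmetric])
    finally show "distr M borel (\<lambda>\<omega>. uniform_KS_stat n (?U \<omega>)) =
        distr (\<Pi>\<^sub>M i\<in>{1..n}. \<mu>) borel (KS_stat n (cdf \<mu>))" .
  qed
qed

end
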